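(* If $U$ is an entrywise nonnegative increasing CBF (constant block form) matrix, then $U$ is in class $\mathcal{T}$.
   Context: All matrices are real and square; inequalities are entrywise; $'$ denotes transpose; $\mathbb{I}$ is the identity matrix; $\mathbf 1$ (or $\mathbf 1_p$) is the vector of ones (of size $p$). Constant block form (CBF) matrices are defined recursively: every $1\times1$ matrix is CBF, and an $n\times n$ matrix ($n\ge 2$) is CBF if for some $1\le p<n$ it has the form $$U=\begin{pmatrix} A & \alpha \mathbf 1_p\mathbf 1_{n-p}'\\ \beta\mathbf 1_{n-p}\mathbf 1_p' & B\end{pmatrix},$$ with $A,B$ CBF matrices of sizes $p$ and $n-p$ and $\alpha,\beta$ real numbers. $U$ is in increasing CBF if (recursively) $A$ and $B$ are in increasing CBF and every entry of $A$ and of $B$ is $\ge\min\{\alpha,\beta\}$ ($1\times 1$ matrices being increasing CBF). A nonnegative matrix $V$ is a bi-potential if it is nonsingular and $(V^{-1})_{ij}\le 0$ for $i\neq j$, $(V^{-1})_{ii}>0$, $\sum_j (V^{-1})_{ij}\ge 0$ for every $i$, and $\sum_i (V^{-1})_{ij}\ge 0$ for every $j$. For a nonnegative matrix $V$, $\tau(V)=\inf\{t\ge 0:\ \mathbb{I}+tV \text{ is not a bi-potential}\}$, with $\inf\emptyset=\infty$. A nonnegative matrix $V$ is in class $\mathcal{T}$ if $$\tau(V)=\inf\{t>0:\ (\mathbb{I}+tV)^{-1}\mathbf 1\not\ge 0\ \text{ or }\ \mathbf 1'(\mathbb{I}+tV)^{-1}\not\ge 0\}$$ (the set being over those $t>0$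 for which $\mathbb{I}+tV$ is nonsingular; $\not\ge 0$ means that some component is negative), and $\mathbb{I}+\tau(V)V$ is nonsingular whenever $\tau(V)<\infty$. *)

theory Defs
  imports
    "Jordan_Normal_Form.Gauss_Jordan_Elimination"
    "HOL-Library.Extended_Real"
begin

inductive cbf :: "real mat \<Rightarrow> bool" where
  single: "U \<in> carrier_mat 1 1 \<Longrightarrow> cbf U"
| block: "cbf (four_block_mat A (mat p q (\<lambda>_. \<alpha>)) (mat q p (\<lambda>_. \<beta>)) B)"
  if "0 < p" "0 < q" "A \<in> carrier_mat p p" "B \<in> carrier_mat q q"
     "cbf A" "cbf B"

text \<open>A matrix may admit several block decompositions; it is increasing if some
  recursive decomposition satisfies the entry condition at every level.\<close>

inductive increasing_cbf :: "real mat \<Rightarrow> bool" where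
  single: "U \<in> carrier_mat 1 1 \<Longrightarrow> increasing_cbf U"
| block: "increasing_cbf (four_block_mat A (mat p q (\<lambda>_. \<alpha>)) (mat q p (\<lambda>_. \<beta>)) B)"
  if "0 < p" "0 < q" "A \<in> carrier_mat p p" "B \<in> carrier_mat q q"
     "increasing_cbf A" "increasing_cbf B"
     "\<forall>a \<in> elements_mat A \<union> elements_mat B. min \<alpha> \<beta> \<le> a"

lemma increasing_cbf_imp_cbf: "increasing_cbf U \<Longrightarrow> cbf U"
  by (induction rule: increasing_cbf.induct) (auto intro: cbf.intros)

lemma cbf_square: "cbf U \<Longrightarrow> 0 < dim_row U \<and> square_mat U"
  by (induction rule: cbf.induct) auto

definition nonneg_mat :: "real mat \<Rightarrow> bool" where
  "nonneg_mat V \<longleftrightarrow> (\<forall>a \<in> elements_mat V. 0 \<le> a)"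

definition nonneg_vec :: "real vec \<Rightarrow> bool" where
  "nonneg_vec v \<longleftrightarrow> (\<forall>i < dim_vec v. 0 \<le> v $ i)"

text \<open>Meaningful only for invertible matrices.\<close>

definition mat_inv :: "real mat \<Rightarrow> real mat" where
  "mat_inv V = the (mat_inverse V)"

lemma mat_inv_inverts:
  assumes V: "V \<in> carrier_mat n n" and inv: "invertible_mat V"
  shows "mat_inv V \<in> carrier_mat n n" "V * mat_inv V = 1\<^sub>m n" "mat_inv V * V = 1\<^sub>m n"
proof -
  obtain W where W: "V * W = 1\<^sub>m n" "W * V = 1\<^sub>m (dim_row W)"
    using V inv by (auto simp: invertible_mat_def inverts_mat_def)
  have "dim_col W = n" using arg_cong[OF W(1), of dim_col] by simp
  moreover have "dim_row W = n" using arg_cong[OF W(2), of dim_col] V by simp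
  ultimately have "V \<in> Units (ring_mat TYPE(real) n ())"
    using V W by (auto simp: Units_def ring_mat_simps intro!: bexI[of _ W])
  then obtain X where "mat_inverse V = Some X"
    using mat_inverse(1)[OF V, of "()"] by (cases "mat_inverse V") auto
  then show "mat_inv V \<in> carrier_mat n n" "V * mat_inv V = 1\<^sub>m n" "mat_inv V * V = 1\<^sub>m n"
    using mat_inverse(2)[OF V] by (auto simp: mat_inv_def)
qed

abbreviation ones_vec :: "nat \<Rightarrow> real vec" where
  "ones_vec n \<equiv> vec n (\<lambda>_. 1)"

definition bi_potential :: "real mat \<Rightarrow> bool" where
  "bi_potential V \<longleftrightarrow>
    square_mat V \<and> nonneg_mat V \<and> invertible_mat V \<and>
    (let n = dim_row V; W = mat_inv V in
      (\<forall>i < n. \<forall>j < n. i \<noteq> j \<longrightarrow> W $$ (i, j) \<le> 0) \<and>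
      (\<forall>i < n. 0 < W $$ (i, i)) \<and>
      (\<forall>i < n. 0 \<le> (\<Sum>j < n. W $$ (i, j))) \<and>
      (\<forall>j < n. 0 \<le> (\<Sum>i < n. W $$ (i, j))))"

definition id_plus :: "real \<Rightarrow> real mat \<Rightarrow> real mat" where
  "id_plus t V = 1\<^sub>m (dim_row V) + t \<cdot>\<^sub>m V"

text \<open>The infima are taken in the extended reals, where the infimum of the empty set is
  \<open>\<infinity>\<close>.\<close>

definition tau :: "real mat \<Rightarrow> ereal" where
  "tau V = Inf (ereal ` {t. 0 \<le> t \<and> \<not> bi_potential (id_plus t V)})"

text \<open>The row vector \<open>1' W\<close> is represented by the column vector \<open>W' 1\<close>.\<close>

definition class_T :: "real mat \<Rightarrow> bool" where
  "class_T V \<longleftrightarrow>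
    square_mat V \<and> nonneg_mat V \<and>
    tau V = Inf (ereal ` {t. 0 < t \<and> invertible_mat (id_plus t V) \<and>
      (\<not> nonneg_vec (mat_inv (id_plus t V) *\<^sub>v ones_vec (dim_row V)) \<or>
       \<not> nonneg_vec (transpose_mat (mat_inv (id_plus t V)) *\<^sub>v ones_vec (dim_row V)))}) \<and>
    (\<forall>t. tau V = ereal t \<longrightarrow> invertible_mat (id_plus t V))"

end

(* Write an n x n increasing CBF matrix in blocks A, B with off-diagonal constants alpha, beta.
   If (I + U) l = 1 and m'(I + U) = 1' have positive solutions l, m, the block equations show that the
   same holds for the blocks, and the Schur complement of I + B in I + U is I + (A - kappa 1 1')
   with kappa <= min alpha beta. So the Schur complement is again I plus a nonnegative increasing
   CBF matrix with positive solutions, and induction on n yields that (I + U)^-1 has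
   nonpositive off-diagonal entries and diagonal entries in (0, 1].

   For t below the second infimum, the solutions for I + t U are nonnegative whenever I + t U is
   nonsingular. By Cramer's rule each of their entries is a quotient of polynomials in t with
   nonzero numerator, so they are positive except for finitely many t. The bound on the
   diagonal makes the inverses uniformly bounded, so they converge as t increases to r: the limit
   I + r U is nonsingular and a bi-potential. *)

theory Submission
  imports Defs "Jordan_Normal_Form.Determinant"
begin

section \<open>Increasing CBF matrices: affine stability and sign pattern of the inverse\<close>

lemma sum_lessThan_add:
  fixes f :: "nat \<Rightarrow> 'a :: comm_monoid_add"
  shows "(\<Sum>k<p + q. f k) = (\<Sum>k<p. f k) + (\<Sum>k<q. f (p + k))"
  by (induction q) (simp_all add: add.assoc)

text \<open>A nonnegative slope preserves the order of the entries and keeps constant blocks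
  constant. Slope 1 covers the shift by a rank-one matrix in a Schur complement,
  \<open>k = 0\<close> the passage from \<open>U\<close> to t U.\<close>

lemma increasing_cbf_affine:
  assumes "increasing_cbf U" and t: "0 \<le> t"
  shows "increasing_cbf (map_mat (\<lambda>x. t * x - k) U)"
  using assms(1)
proof (induction rule: increasing_cbf.induct)
  case (single U)
  then show ?case by (intro increasing_cbf.single) auto
next
  case (block p q A B \<alpha> \<beta>)
  let ?f = "\<lambda>x. t * x - k"
  have "map_mat ?f (four_block_mat A (mat p q (\<lambda>_. \<alpha>)) (mat q p (\<lambda>_. \<beta>)) B)
    = four_block_mat (map_mat ?f A) (mat p q (\<lambda>_. ?f \<alpha>)) (mat q p (\<lambda>_. ?f \<beta>)) (map_mat ?f B)"
    using block by (subst map_four_block_mat[of _ p p _ q _ q]) auto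
  moreover have "min (?f \<alpha>) (?f \<beta>) \<le> ?f a" if "min \<alpha> \<beta> \<le> a" for a
    using that mult_left_mono[OF _ t, of \<alpha> a] mult_left_mono[OF _ t, of \<beta> a]
    by (cases "\<alpha> \<le> \<beta>") (auto simp: min_le_iff_disj)
  then have "\<forall>a \<in> elements_mat (map_mat ?f A) \<union> elements_mat (map_mat ?f B).
      min (?f \<alpha>) (?f \<beta>) \<le> a"
    using block.hyps by (fastforce simp: elements_mat_def)
  ultimately show ?case
    using block by (auto intro!: increasing_cbf.block)
qed

text \<open>Both sides equal y'(I + K)x. With \<open>e\<close> and \<open>f\<close> constantly 1,
  row and column solutions have equal sums; with \<open>f\<close> a unit vector, the column sums of
  an inverse come out.\<close>

lemma pairing_solutions:
  fixes K :: "nat \<Rightarrow> nat \<Rightarrow> 'a :: comm_semiring_0"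
  assumes "\<And>k. k < n \<Longrightarrow> y k + (\<Sum>i<n. y i * K i k) = e k"
    and "\<And>i. i < n \<Longrightarrow> x i + (\<Sum>k<n. K i k * x k) = f i"
  shows "(\<Sum>k<n. e k * x k) = (\<Sum>i<n. y i * f i)"
proof -
  have "(\<Sum>k<n. e k * x k) = (\<Sum>k<n. y k * x k) + (\<Sum>k<n. \<Sum>i<n. y i * K i k * x k)"
    using assms(1) by (simp flip: sum.distrib sum_distrib_right add: distrib_right[symmetric])
  also have "(\<Sum>k<n. \<Sum>i<n. y i * K i k * x k) = (\<Sum>i<n. \<Sum>k<n. y i * K i k * x k)"
    by (rule sum.swap)
  also have "(\<Sum>k<n. y k * x k) + \<dots> = (\<Sum>i<n. y i * (x i + (\<Sum>k<n. K i k * x k)))"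
    by (simp add: distrib_left sum.distrib sum_distrib_left mult.assoc)
  also have "\<dots> = (\<Sum>i<n. y i * f i)"
    using assms(2) by simp
  finally show ?thesis .
qed

text \<open>The bound \<open>W i i \<le> 1\<close> is what makes the inverses of \<open>I + t U\<close> uniformly bounded in \<open>t\<close>.\<close>

lemma increasing_cbf_inverse:
  fixes l m :: "nat \<Rightarrow> real"
  assumes "increasing_cbf V" "nonneg_mat V" "V \<in> carrier_mat n n"
    and "\<And>i. i < n \<Longrightarrow> 0 < l i" "\<And>i. i < n \<Longrightarrow> 0 < m i"
    and "\<And>i. i < n \<Longrightarrow> l i + (\<Sum>k<n. V $$ (i, k) * l k) = 1"
    and "\<And>j. j < n \<Longrightarrow> m j + (\<Sum>k<n. m k * V $$ (k, j)) = 1"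
  shows "\<exists>W. (\<forall>i<n. \<forall>j<n. W i j + (\<Sum>k<n. V $$ (i, k) * W k j) = of_bool (i = j)) \<and>
    (\<forall>i<n. 0 < W i i \<and> W i i \<le> 1) \<and> (\<forall>i<n. \<forall>j<n. i \<noteq> j \<longrightarrow> W i j \<le> 0)"
    (is "\<exists>W. ?inv n V W")
  using assms
proof (induction n arbitrary: V l m rule: less_induct)
  case (less n)
  note pos = less.prems(4,5) and solves = less.prems(6,7)
  \<comment> \<open>Subtracting \<open>\<kappa>\<close> from all entries of \<open>A\<close> rescales the solutions by \<open>1 / (1 - \<kappa> * sum x)\<close>.\<close>
  have shifted: "\<exists>C. (\<forall>i<p. \<forall>j<p. C i j + (\<Sum>k<p. A $$ (i, k) * C k j)
          = of_bool (i = j) + \<kappa> * y j / (1 - \<kappa> * (\<Sum>k<p. x k))) \<and>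
      (\<forall>j<p. (\<Sum>k<p. C k j) = y j / (1 - \<kappa> * (\<Sum>k<p. x k))) \<and>
      (\<forall>i<p. 0 < C i i \<and> C i i \<le> 1) \<and> (\<forall>i<p. \<forall>j<p. i \<noteq> j \<longrightarrow> C i j \<le> 0)"
    if "p < n" and A: "A \<in> carrier_mat p p" "increasing_cbf A"
      and \<kappa>: "\<And>i j. i < p \<Longrightarrow> j < p \<Longrightarrow> \<kappa> \<le> A $$ (i, j)" "\<kappa> * (\<Sum>k<p. x k) < 1"
      and xy: "\<And>i. i < p \<Longrightarrow> 0 < x i" "\<And>i. i < p \<Longrightarrow> 0 < y i"
        "\<And>i. i < p \<Longrightarrow> x i + (\<Sum>k<p. A $$ (i, k) * x k) = 1"
        "\<And>j. j < p \<Longrightarrow> y j + (\<Sum>k<p. y k * A $$ (k, j)) = 1"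
    for p A \<kappa> and x y :: "nat \<Rightarrow> real"
  proof -
    define \<Delta> where "\<Delta> = 1 - \<kappa> * (\<Sum>k<p. x k)"
    \<comment> \<open>The factor 1 gives the shift the shape required by
      \<open>increasing_cbf_affine\<close>.\<close>
    let ?K = "map_mat (\<lambda>x. 1 * x - \<kappa>) A"
    have "0 < \<Delta>" using \<kappa>(2) by (simp add: \<Delta>_def)
    \<comment> \<open>\<Delta> is built from \<open>x\<close>; equality of the sums lets the same
      scaling work for \<open>y\<close>.\<close>
    have sum_eq: "(\<Sum>k<p. x k) = (\<Sum>k<p. y k)"
      using pairing_solutions[of p y "\<lambda>i j. A $$ (i, j)" "\<lambda>_. 1" x "\<lambda>_. 1"] xy by simp
    have x\<Delta>: "x i / \<Delta> + (\<Sum>k<p. ?K $$ (i, k) * (x k / \<Delta>)) = 1" if "i < p" for i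
    proof -
      have "x i + (\<Sum>k<p. (A $$ (i, k) - \<kappa>) * x k) = \<Delta>"
        using xy(3)[OF that] by (simp add: \<Delta>_def algebra_simps sum_subtractf sum_distrib_left)
      then show ?thesis
        using \<open>0 < \<Delta>\<close> that A by (simp add: add_divide_distrib[symmetric] sum_divide_distrib[symmetric])
    qed
    have y\<Delta>: "y j / \<Delta> + (\<Sum>k<p. (y k / \<Delta>) * ?K $$ (k, j)) = 1" if "j < p" for j
    proof -
      have "y j + (\<Sum>k<p. y k * (A $$ (k, j) - \<kappa>)) = \<Delta>"
        using xy(4)[OF that]
        by (simp add: \<Delta>_def sum_eq algebra_simps sum_subtractf sum_distrib_left)
      then show ?thesis
        using \<open>0 < \<Delta>\<close> that A by (simp add: add_divide_distrib[symmetric] sum_divide_distrib[symmetric])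
    qed
    have K: "nonneg_mat ?K"
      using A \<kappa>(1) by (auto simp: nonneg_mat_def elements_mat_def)
    have K': "increasing_cbf ?K" "?K \<in> carrier_mat p p"
      using A increasing_cbf_affine[OF A(2), of 1 \<kappa>] by auto
    have pos\<Delta>: "0 < x i / \<Delta>" "0 < y i / \<Delta>" if "i < p" for i
      using xy(1,2) that \<open>0 < \<Delta>\<close> by simp_all
    have "\<exists>W. ?inv p ?K W"
      by (rule less.IH[OF \<open>p < n\<close> K'(1) K K'(2),
            of "\<lambda>i. x i / \<Delta>" "\<lambda>i. y i / \<Delta>", OF pos\<Delta> x\<Delta> y\<Delta>])
    then obtain C where
      C: "\<forall>i<p. \<forall>j<p. C i j + (\<Sum>k<p. ?K $$ (i, k) * C k j) = of_bool (i = j)"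
        "\<forall>i<p. 0 < C i i \<and> C i i \<le> 1" "\<forall>i<p. \<forall>j<p. i \<noteq> j \<longrightarrow> C i j \<le> 0"
      by (elim exE conjE)
    \<comment> \<open>Pairing the left solution y / \<Delta> with column \<open>j\<close> of
      \<open>C\<close> yields the column sum.\<close>
    have col: "(\<Sum>k<p. C k j) = y j / \<Delta>" if "j < p" for j
    proof -
      have "(\<Sum>k<p. C k j) = (\<Sum>i<p. y i / \<Delta> * of_bool (i = j))"
        using pairing_solutions[of p "\<lambda>i. y i / \<Delta>" "\<lambda>i j. ?K $$ (i, j)" "\<lambda>_. 1" "\<lambda>k. C k j"
            "\<lambda>i. of_bool (i = j)"] y\<Delta> C(1) that by simp
      also have "\<dots> = (\<Sum>i<p. if i = j then y i / \<Delta> else 0)"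
        by (rule sum.cong) auto
      finally show ?thesis using that by simp
    qed
    \<comment> \<open>Passing from \<open>?K\<close> back to \<open>A\<close> adds \<kappa> times
      the column sum of \<open>C\<close>.\<close>
    have "C i j + (\<Sum>k<p. A $$ (i, k) * C k j) = of_bool (i = j) + \<kappa> * y j / \<Delta>"
      if ij: "i < p" "j < p" for i j
    proof -
      have "C i j + (\<Sum>k<p. A $$ (i, k) * C k j) = of_bool (i = j) + \<kappa> * (\<Sum>k<p. C k j)"
        using C(1) A ij by (simp add: algebra_simps sum_subtractf sum_distrib_left)
      then show ?thesis using col[OF ij(2)] by simp
    qed
    then show ?thesis
      using C(2,3) col unfolding \<Delta>_def[symmetric] by blast
  qed
  have nonneg: "0 \<le> V $$ (i, j)" if "i < n" "j < n" for i j
    using less.prems(2,3) that unfolding nonneg_mat_def by blast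
  from less.prems(1) show ?case
  proof (cases rule: increasing_cbf.cases)
    case single
    then have [simp]: "n = 1" using less.prems(3) by auto
    have "0 \<le> V $$ (0, 0)" using nonneg by simp
    then show ?thesis
      by (intro exI[of _ "\<lambda>_ _. 1 / (1 + V $$ (0, 0))"]) (simp add: field_simps)
  next
    case (block p q A B \<alpha> \<beta>)
    note V = block(1) and pq = block(2,3) and A = block(4,6) and B = block(5,7) and inc = block(8)
    have n: "n = p + q"
      using V less.prems(3) A B by auto
    have entry: "\<And>i j. i < p \<Longrightarrow> j < p \<Longrightarrow> V $$ (i, j) = A $$ (i, j)"
      "\<And>i j. i < p \<Longrightarrow> j < q \<Longrightarrow> V $$ (i, p + j) = \<alpha>"
      "\<And>i j. i < q \<Longrightarrow> j < p \<Longrightarrow> V $$ (p + i, j) = \<beta>"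
      "\<And>i j. i < q \<Longrightarrow> j < q \<Longrightarrow> V $$ (p + i, p + j) = B $$ (i, j)"
      using A B by (simp_all add: V)
    have [simp]: "0 \<le> \<alpha>" "0 \<le> \<beta>"
      using nonneg[of 0 p] nonneg[of p 0] entry(2,3)[of 0 0] pq n by auto
    have A_ge: "min \<alpha> \<beta> \<le> A $$ (i, j)" if "i < p" "j < p" for i j
      using inc A that by blast
    have B_ge: "min \<alpha> \<beta> \<le> B $$ (i, j)" if "i < q" "j < q" for i j
      using inc B that by blast
    have A_nonneg: "0 \<le> A $$ (i, j)" if "i < p" "j < p" for i j
      using A_ge[OF that] by (simp add: min_def split: if_splits) (use \<open>0 \<le> \<alpha>\<close> \<open>0 \<le> \<beta>\<close> in linarith)+
    have B_nonneg: "0 \<le> B $$ (i, j)" if "i < q" "j < q" for i j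
      using B_ge[OF that] by (simp add: min_def split: if_splits) (use \<open>0 \<le> \<alpha>\<close> \<open>0 \<le> \<beta>\<close> in linarith)+
    define s1 s2 r1 r2 where "s1 = (\<Sum>k<p. l k)" and "s2 = (\<Sum>k<q. l (p + k))"
      and "r1 = (\<Sum>k<p. m k)" and "r2 = (\<Sum>k<q. m (p + k))"
    have s_pos: "0 < s1" "0 < s2" "0 < r1" "0 < r2"
      unfolding s1_def s2_def r1_def r2_def using pos pq n by (auto intro!: sum_pos)
    have l1: "l i + (\<Sum>k<p. A $$ (i, k) * l k) = 1 - \<alpha> * s2" if "i < p" for i
      using solves(1)[of i] that n entry pq
      by (simp add: sum_lessThan_add s2_def sum_distrib_left algebra_simps)
    have l2: "l (p + i) + (\<Sum>k<q. B $$ (i, k) * l (p + k)) = 1 - \<beta> * s1" if "i < q" for i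
      using solves(1)[of "p + i"] that n entry pq
      by (simp add: sum_lessThan_add s1_def sum_distrib_left algebra_simps)
    have m1: "m j + (\<Sum>k<p. m k * A $$ (k, j)) = 1 - \<beta> * r2" if "j < p" for j
      using solves(2)[of j] that n entry pq
      by (simp add: sum_lessThan_add r2_def sum_distrib_left algebra_simps)
    have m2: "m (p + j) + (\<Sum>k<q. m (p + k) * B $$ (k, j)) = 1 - \<alpha> * r1" if "j < q" for j
      using solves(2)[of "p + j"] that n entry pq
      by (simp add: sum_lessThan_add r1_def sum_distrib_left algebra_simps)
    \<comment> \<open>These are the common right-hand sides of the block equations. Dividing by them
      turns the restrictions of \<open>l\<close> and \<open>m\<close> into solutions for
      \<open>A\<close> and \<open>B\<close> with right-hand side 1.\<close>
    define g1 g2 h1 h2 where "g1 = 1 - \<alpha> * s2" and "g2 = 1 - \<beta> * s1"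
      and "h1 = 1 - \<beta> * r2" and "h2 = 1 - \<alpha> * r1"
    \<comment> \<open>Each constant is read off from the first row or column of its block: a
      positive entry of \<open>l\<close> or \<open>m\<close> plus a nonnegative sum.\<close>
    have gh: "0 < g1" "0 < g2" "0 < h1" "0 < h2"
    proof -
      have "0 \<le> (\<Sum>k<p. A $$ (0, k) * l k)" "0 \<le> (\<Sum>k<p. m k * A $$ (k, 0))"
        "0 \<le> (\<Sum>k<q. B $$ (0, k) * l (p + k))" "0 \<le> (\<Sum>k<q. m (p + k) * B $$ (k, 0))"
        using A_nonneg B_nonneg less_imp_le[OF pos(1)] less_imp_le[OF pos(2)] pq n
        by (auto intro!: sum_nonneg mult_nonneg_nonneg)
      then show "0 < g1" "0 < g2" "0 < h1" "0 < h2"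
        using l1[of 0] l2[of 0] m1[of 0] m2[of 0] pos[of 0] pos[of p] pq n
        unfolding g1_def g2_def h1_def h2_def by auto
    qed
    define lA mA lB mB where "lA i = l i / g1" and "mA i = m i / h1"
      and "lB i = l (p + i) / g2" and "mB i = m (p + i) / h2" for i
    have pos': "i < p \<Longrightarrow> 0 < lA i" "i < p \<Longrightarrow> 0 < mA i" "i < q \<Longrightarrow> 0 < lB i" "i < q \<Longrightarrow> 0 < mB i" for i
      unfolding lA_def mA_def lB_def mB_def using pos gh n by auto
    have lA: "lA i + (\<Sum>k<p. A $$ (i, k) * lA k) = 1" if "i < p" for i
      using l1[OF that] gh unfolding lA_def g1_def[symmetric]
      by (simp add: add_divide_distrib[symmetric] sum_divide_distrib[symmetric])
    have lB: "lB i + (\<Sum>k<q. B $$ (i, k) * lB k) = 1" if "i < q" for i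
      using l2[OF that] gh unfolding lB_def g2_def[symmetric]
      by (simp add: add_divide_distrib[symmetric] sum_divide_distrib[symmetric])
    have mA: "mA j + (\<Sum>k<p. mA k * A $$ (k, j)) = 1" if "j < p" for j
      using m1[OF that] gh unfolding mA_def h1_def[symmetric]
      by (simp add: add_divide_distrib[symmetric] sum_divide_distrib[symmetric])
    have mB: "mB j + (\<Sum>k<q. mB k * B $$ (k, j)) = 1" if "j < q" for j
      using m2[OF that] gh unfolding mB_def h2_def[symmetric]
      by (simp add: add_divide_distrib[symmetric] sum_divide_distrib[symmetric])
    \<comment> \<open>\<open>a\<close> and \<open>b\<close> play the role of the entry sums 1'(I +
      A)^-1 1 and 1'(I + B)^-1 1.\<close>
    define a b where "a = (\<Sum>k<p. lA k)" and "b = (\<Sum>k<q. lB k)"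
    have a_eq: "a = (\<Sum>k<p. mA k)" and b_eq: "b = (\<Sum>k<q. mB k)"
      using pairing_solutions[of p mA "\<lambda>i j. A $$ (i, j)" "\<lambda>_. 1" lA "\<lambda>_. 1"] lA mA
        pairing_solutions[of q mB "\<lambda>i j. B $$ (i, j)" "\<lambda>_. 1" lB "\<lambda>_. 1"] lB mB
      by (simp_all add: a_def b_def)
    have "a = s1 / g1" "b = s2 / g2"
      by (simp_all add: a_def b_def s1_def s2_def lA_def lB_def sum_divide_distrib)
    moreover have "a = r1 / h1" "b = r2 / h2"
      by (simp_all add: a_eq b_eq r1_def r2_def mA_def mB_def sum_divide_distrib)
    ultimately have rel: "s1 = a * g1" "s2 = b * g2" "r1 = a * h1" "r2 = b * h2"
      using gh by (metis less_irrefl nonzero_eq_divide_eq)+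
    have ab: "0 < a" "0 < b"
      using rel gh s_pos by (metis zero_less_mult_pos2)+
    \<comment> \<open>\<Delta> is the determinant of the system s1 + \<alpha> a s2 = a, \<beta> b s1
      + s2 = b, and also of the one for \<open>r1\<close>, \<open>r2\<close> with \<alpha> and
      \<beta> exchanged. The equations \<open>eqs\<close> are Cramer's formulas for both.\<close>
    define \<Delta> where "\<Delta> = 1 - \<alpha> * \<beta> * a * b"
    have eqs: "s1 * \<Delta> = a * (1 - \<alpha> * b)" "s2 * \<Delta> = b * (1 - \<beta> * a)"
      "r1 * \<Delta> = a * (1 - \<beta> * b)" "r2 * \<Delta> = b * (1 - \<alpha> * a)"
    proof -
      have "s1 = a * (1 - \<alpha> * (b * (1 - \<beta> * s1)))" "s2 = b * (1 - \<beta> * (a * (1 - \<alpha> * s2)))"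
        "r1 = a * (1 - \<beta> * (b * (1 - \<alpha> * r1)))" "r2 = b * (1 - \<alpha> * (a * (1 - \<beta> * r2)))"
        using rel unfolding g1_def g2_def h1_def h2_def by simp_all
      then show "s1 * \<Delta> = a * (1 - \<alpha> * b)" "s2 * \<Delta> = b * (1 - \<beta> * a)"
        "r1 * \<Delta> = a * (1 - \<beta> * b)" "r2 * \<Delta> = b * (1 - \<alpha> * a)"
        unfolding \<Delta>_def by (simp_all add: algebra_simps)
    qed
    \<comment> \<open>The first equation for \<open>lA\<close> has a positive term
      \<open>lA 0\<close>, and the entries of \<open>A\<close> in it are at least min \<alpha>
      \<beta>.\<close>
    have min_a: "min \<alpha> \<beta> * a < 1"
    proof -
      have "min \<alpha> \<beta> * a \<le> (\<Sum>k<p. A $$ (0, k) * lA k)"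
        unfolding a_def sum_distrib_left
        using A_ge pos' pq by (auto intro!: sum_mono mult_right_mono simp: less_imp_le)
      also have "\<dots> < 1" using lA[of 0] pos'(1)[of 0] pq by simp
      finally show ?thesis .
    qed
    \<comment> \<open>Otherwise the formulas for \<open>s2\<close> and \<open>r2\<close> make both
      \<beta> a and \<alpha> a at least 1, against \<open>min_a\<close> for the smaller
      constant.\<close>
    have "0 < \<Delta>"
    proof (rule ccontr)
      assume "\<not> 0 < \<Delta>"
      then have "s2 * \<Delta> \<le> 0" "r2 * \<Delta> \<le> 0"
        using s_pos by (simp_all add: mult_nonneg_nonpos)
      then have "1 \<le> \<beta> * a" "1 \<le> \<alpha> * a"
        using eqs ab by (auto simp: mult_le_0_iff)
      then show False using min_a by (auto simp: min_def split: if_splits)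
    qed
    then have less1: "\<alpha> * b < 1" "\<beta> * a < 1" "\<beta> * b < 1" "\<alpha> * a < 1"
    proof -
      have "0 < a * (1 - \<alpha> * b)" "0 < b * (1 - \<beta> * a)" "0 < a * (1 - \<beta> * b)" "0 < b * (1 - \<alpha> * a)"
        using \<open>0 < \<Delta>\<close> s_pos by (simp_all flip: eqs)
      then show "\<alpha> * b < 1" "\<beta> * a < 1" "\<beta> * b < 1" "\<alpha> * a < 1"
        using ab by (simp_all add: zero_less_mult_iff)
    qed
    \<comment> \<open>Eliminating the block I + B subtracts \<alpha> \<beta> b from every entry of
      \<open>A\<close>, eliminating I + A subtracts \<alpha> \<beta> a from every entry of
      \<open>B\<close>. By \<open>less1\<close> these shifts stay below all entries of the blocks,
      so the shifted blocks are nonnegative.\<close>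
    have \<kappa>: "\<alpha> * \<beta> * b \<le> min \<alpha> \<beta>" "\<alpha> * \<beta> * a \<le> min \<alpha> \<beta>"
      using mult_left_mono[of "\<beta> * b" 1 \<alpha>] mult_left_mono[of "\<alpha> * b" 1 \<beta>]
        mult_left_mono[of "\<beta> * a" 1 \<alpha>] mult_left_mono[of "\<alpha> * a" 1 \<beta>] less1
      by (simp_all add: ac_simps)
    have \<Delta>': "1 - \<alpha> * \<beta> * b * (\<Sum>k<p. lA k) = \<Delta>" "1 - \<alpha> * \<beta> * a * (\<Sum>k<q. lB k) = \<Delta>"
      by (simp_all add: \<Delta>_def a_def b_def)
    have \<kappa>': "\<alpha> * \<beta> * b * (\<Sum>k<p. lA k) < 1" "\<alpha> * \<beta> * a * (\<Sum>k<q. lB k) < 1"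
      using \<Delta>' \<open>0 < \<Delta>\<close> by linarith+
    \<comment> \<open>\<open>C\<close> inverts the Schur complement I + A - \<alpha> \<beta> b 1 1';
      its equation is stated with \<open>A\<close>, so the shift appears as a surplus on the right.
      \<open>D\<close> below is its mirror image.\<close>
    obtain C where
        C: "\<forall>i<p. \<forall>j<p. C i j + (\<Sum>k<p. A $$ (i, k) * C k j)
          = of_bool (i = j) + \<alpha> * \<beta> * b * mA j / \<Delta>"
        "\<forall>j<p. (\<Sum>k<p. C k j) = mA j / \<Delta>" "\<forall>i<p. 0 < C i i \<and> C i i \<le> 1"
        "\<forall>i<p. \<forall>j<p. i \<noteq> j \<longrightarrow> C i j \<le> 0"
      using shifted[of p A "\<alpha> * \<beta> * b" lA mA, OF _ A order_trans[OF \<kappa>(1) A_ge] \<kappa>'(1) pos'(1,2) lA mA]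
        n pq unfolding \<Delta>' by (auto elim!: exE conjE)
    obtain D where
        D: "\<forall>i<q. \<forall>j<q. D i j + (\<Sum>k<q. B $$ (i, k) * D k j)
          = of_bool (i = j) + \<alpha> * \<beta> * a * mB j / \<Delta>"
        "\<forall>j<q. (\<Sum>k<q. D k j) = mB j / \<Delta>" "\<forall>i<q. 0 < D i i \<and> D i i \<le> 1"
        "\<forall>i<q. \<forall>j<q. i \<noteq> j \<longrightarrow> D i j \<le> 0"
      using shifted[of q B "\<alpha> * \<beta> * a" lB mB, OF _ B order_trans[OF \<kappa>(2) B_ge] \<kappa>'(2) pos'(3,4) lB mB]
        n pq unfolding \<Delta>' by (auto elim!: exE conjE)
    \<comment> \<open>The inverse from the two Schur complements.\<close>
    define W where "W i j = (if i < p then if j < p then C i j else - \<alpha> / \<Delta> * lA i * mB (j - p)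
      else if j < p then - \<beta> / \<Delta> * lB (i - p) * mA j else D (i - p) (j - p))" for i j
    have W: "\<And>i j. i < p \<Longrightarrow> j < p \<Longrightarrow> W i j = C i j"
      "\<And>i j. i < p \<Longrightarrow> W i (p + j) = - \<alpha> / \<Delta> * lA i * mB j"
      "\<And>i j. j < p \<Longrightarrow> W (p + i) j = - \<beta> / \<Delta> * lB i * mA j" "\<And>i j. W (p + i) (p + j) = D i j"
      by (simp_all add: W_def)
    have split: "i < p \<or> (\<exists>i'<q. i = p + i')" if "i < n" for i
      using that n by (metis add_less_cancel_left le_add_diff_inverse not_less)
    \<comment> \<open>In a diagonal block the surplus of \<open>C\<close> or \<open>D\<close>
      cancels against the contribution of an off-diagonal block of \<open>W\<close>. In an
      off-diagonal block the equation for \<open>lA\<close> or \<open>lB\<close> leaves a term that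
      the column sum of \<open>D\<close> or \<open>C\<close> cancels.\<close>
    have "W i j + (\<Sum>k<n. V $$ (i, k) * W k j) = of_bool (i = j)" if ij: "i < n" "j < n" for i j
    proof -
      consider "i < p" "j < p" | j' where "i < p" "j' < q" "j = p + j'"
        | i' where "i' < q" "j < p" "i = p + i'" | i' j' where "i' < q" "j' < q" "i = p + i'" "j = p + j'"
        using split[OF ij(1)] split[OF ij(2)] by blast
      then show ?thesis
      proof cases
        case 1
        have "W i j + (\<Sum>k<n. V $$ (i, k) * W k j)
          = C i j + (\<Sum>k<p. A $$ (i, k) * C k j) + (\<Sum>k<q. \<alpha> * (- \<beta> / \<Delta> * lB k * mA j))"
          using 1 by (simp add: n sum_lessThan_add entry W)
        also have "(\<Sum>k<q. \<alpha> * (- \<beta> / \<Delta> * lB k * mA j)) = - (\<alpha> * \<beta> * b * mA j / \<Delta>)"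
          by (simp add: b_def sum_distrib_left sum_distrib_right sum_divide_distrib sum_negf ac_simps)
        finally show ?thesis using C(1) 1 by simp
      next
        case 2
        have "W i j + (\<Sum>k<n. V $$ (i, k) * W k j) = - \<alpha> / \<Delta> * lA i * mB j'
          + (\<Sum>k<p. A $$ (i, k) * (- \<alpha> / \<Delta> * lA k * mB j')) + \<alpha> * (\<Sum>k<q. D k j')"
          using 2 by (simp add: n sum_lessThan_add entry W sum_distrib_left)
        also have "\<dots> = - \<alpha> / \<Delta> * mB j' * (lA i + (\<Sum>k<p. A $$ (i, k) * lA k)) + \<alpha> * (\<Sum>k<q. D k j')"
          by (simp add: distrib_left sum_distrib_left sum_negf ac_simps)
        also have "\<dots> = 0" using lA D(2) 2 by simp
        finally show ?thesis using 2 by simp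
      next
        case 3
        have "W i j + (\<Sum>k<n. V $$ (i, k) * W k j) = - \<beta> / \<Delta> * lB i' * mA j
          + (\<Sum>k<q. B $$ (i', k) * (- \<beta> / \<Delta> * lB k * mA j)) + \<beta> * (\<Sum>k<p. C k j)"
          using 3 by (simp add: n sum_lessThan_add entry W sum_distrib_left)
        also have "\<dots> = - \<beta> / \<Delta> * mA j * (lB i' + (\<Sum>k<q. B $$ (i', k) * lB k)) + \<beta> * (\<Sum>k<p. C k j)"
          by (simp add: distrib_left sum_distrib_left sum_negf ac_simps)
        also have "\<dots> = 0" using lB C(2) 3 by simp
        finally show ?thesis using 3 by simp
      next
        case 4
        have "W i j + (\<Sum>k<n. V $$ (i, k) * W k j)
          = D i' j' + (\<Sum>k<q. B $$ (i', k) * D k j') + (\<Sum>k<p. \<beta> * (- \<alpha> / \<Delta> * lA k * mB j'))"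
          using 4 by (simp add: n sum_lessThan_add entry W)
        also have "(\<Sum>k<p. \<beta> * (- \<alpha> / \<Delta> * lA k * mB j')) = - (\<alpha> * \<beta> * a * mB j' / \<Delta>)"
          by (simp add: a_def sum_distrib_left sum_distrib_right sum_divide_distrib sum_negf ac_simps)
        finally show ?thesis using D(1) 4 by simp
      qed
    qed
    moreover have "0 < W i i \<and> W i i \<le> 1" if "i < n" for i
      using C(3) D(3) that n by (auto simp: W_def)
    moreover have "W i j \<le> 0" if "i < n" "j < n" "i \<noteq> j" for i j
      using C(4) D(4) that n less_imp_le[OF \<open>0 < \<Delta>\<close>] less_imp_le[OF pos'(1)] less_imp_le[OF pos'(2)]
        less_imp_le[OF pos'(3)] less_imp_le[OF pos'(4)]
      by (auto simp: W_def)
    ultimately show ?thesis by blast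
  qed
qed


section \<open>The pencil I + t V and its exceptional parameters\<close>

lemma invertible_mat_iff_det:
  fixes A :: "'a :: field mat"
  assumes A: "A \<in> carrier_mat n n"
  shows "invertible_mat A \<longleftrightarrow> det A \<noteq> 0"
proof
  assume "invertible_mat A"
  then obtain B where AB: "A * B = 1\<^sub>m n" "B * A = 1\<^sub>m (dim_row B)"
    using A by (auto simp: invertible_mat_def inverts_mat_def)
  have "B \<in> carrier_mat n n"
    using arg_cong[OF AB(1), of dim_col] arg_cong[OF AB(2), of dim_col] A by auto
  then have "det A * det B = 1" using det_mult[OF A] AB(1) by (metis det_one)
  then show "det A \<noteq> 0" by auto
next
  assume "det A \<noteq> 0"
  then obtain B where "B \<in> carrier_mat n n" "A * B = 1\<^sub>m n" "B * A = 1\<^sub>m n"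
    using det_non_zero_imp_unit[OF A, of "()"] by (auto simp: Units_def ring_mat_simps)
  then show "invertible_mat A"
    using A by (auto simp: invertible_mat_def inverts_mat_def)
qed

lemma nonneg_mat_iff:
  "V \<in> carrier_mat n m \<Longrightarrow> nonneg_mat V \<longleftrightarrow> (\<forall>i<n. \<forall>j<m. 0 \<le> V $$ (i, j))"
  unfolding nonneg_mat_def by blast

lemma mult_mat_vec_index:
  assumes "A \<in> carrier_mat n m" "x \<in> carrier_vec m" "i < n"
  shows "(A *\<^sub>v x) $ i = (\<Sum>k<m. A $$ (i, k) * x $ k)"
  using assms by (simp add: scalar_prod_def lessThan_atLeast0)

lemma id_plus_carrier [simp]: "V \<in> carrier_mat n n \<Longrightarrow> id_plus t V \<in> carrier_mat n n"
  by (auto simp: id_plus_def)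

lemma id_plus_index:
  "V \<in> carrier_mat n n \<Longrightarrow> i < n \<Longrightarrow> j < n \<Longrightarrow>
    id_plus t V $$ (i, j) = of_bool (i = j) + t * V $$ (i, j)"
  by (auto simp: id_plus_def)

lemma id_plus_0: "V \<in> carrier_mat n n \<Longrightarrow> id_plus 0 V = 1\<^sub>m n"
  by (rule eq_matI) (auto simp: id_plus_def)

lemma id_plus_transpose:
  "V \<in> carrier_mat n n \<Longrightarrow> id_plus t (transpose_mat V) = transpose_mat (id_plus t V)"
  by (rule eq_matI) (auto simp: id_plus_def)

lemma id_plus_mult_vec:
  assumes V: "V \<in> carrier_mat n n" and x: "x \<in> carrier_vec n"
  shows "id_plus t V *\<^sub>v x = x + t \<cdot>\<^sub>v (V *\<^sub>v x)"
proof (rule eq_vecI)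
  fix i assume "i < dim_vec (x + t \<cdot>\<^sub>v (V *\<^sub>v x))"
  then have i: "i < n" using V by simp
  have "(\<Sum>k<n. of_bool (i = k) * x $ k) = (\<Sum>k<n. if k = i then x $ k else 0)"
    by (rule sum.cong) auto
  then have "(\<Sum>k<n. of_bool (i = k) * x $ k) = x $ i"
    using i by simp
  then show "(id_plus t V *\<^sub>v x) $ i = (x + t \<cdot>\<^sub>v (V *\<^sub>v x)) $ i"
    using V x i mult_mat_vec_index[OF id_plus_carrier[OF V] x i, of t] mult_mat_vec_index[OF V x i]
    by (simp add: id_plus_index distrib_right sum.distrib sum_distrib_left mult.assoc del: index_mult_mat_vec)
qed (use V in \<open>auto simp: id_plus_def\<close>)

lemma poly_det: "poly (det P) t = det (map_mat (\<lambda>p. poly p t) P)"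
proof -
  interpret comm_ring_hom "\<lambda>p. poly p t" by unfold_locales auto
  show ?thesis by simp
qed

text \<open>The pencil with an indeterminate in place of t, so that its determinants are polynomials
  with finitely many roots unless zero.\<close>

definition id_plus_poly :: "real mat \<Rightarrow> real poly mat" where
  "id_plus_poly V = mat (dim_row V) (dim_row V) (\<lambda>(i, j). [:of_bool (i = j), V $$ (i, j):])"

lemma eval_id_plus_poly:
  "V \<in> carrier_mat n n \<Longrightarrow> map_mat (\<lambda>p. poly p t) (id_plus_poly V) = id_plus t V"
  by (rule eq_matI) (auto simp: id_plus_poly_def id_plus_def)

text \<open>The determinant is a polynomial in t with value 1 at t = 0.\<close>

lemma finite_singular_id_plus:
  assumes V: "V \<in> carrier_mat n n"
  shows "finite {t. det (id_plus t V) = 0}"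
proof -
  have eval: "poly (det (id_plus_poly V)) t = det (id_plus t V)" for t
    by (simp add: poly_det eval_id_plus_poly[OF V])
  from eval[of 0] have "det (id_plus_poly V) \<noteq> 0"
    using V by (auto simp: id_plus_0)
  then show ?thesis
    using poly_roots_finite by (simp flip: eval)
qed

text \<open>By Cramer's rule, \<open>x $ i\<close> times the determinant is a polynomial in t,
  namely the determinant after replacing column \<open>i\<close> by ones. It equals 1 at t = 0, and
  it vanishes whenever \<open>x $ i\<close> does, even at singular parameters.\<close>

lemma finite_vanishing_solution:
  assumes V: "V \<in> carrier_mat n n" and i: "i < n"
  shows "finite {t. \<exists>x \<in> carrier_vec n. id_plus t V *\<^sub>v x = ones_vec n \<and> x $ i = 0}"
proof -
  define q where "q = det (replace_col (id_plus_poly V) (vec n (\<lambda>_. 1)) i)"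
  have "map_mat (\<lambda>p. poly p t) (replace_col (id_plus_poly V) (vec n (\<lambda>_. 1)) i)
    = replace_col (id_plus t V) (ones_vec n) i" for t
    using V unfolding eval_id_plus_poly[OF V, symmetric]
    by (intro eq_matI) (auto simp: replace_col_def id_plus_poly_def)
  then have q: "poly q t = det (replace_col (id_plus t V) (ones_vec n) i)" for t
    unfolding q_def by (simp add: poly_det)
  have "poly q 0 = 1"
    using cramer_lemma_mat[of "1\<^sub>m n" n "ones_vec n" i] i V by (simp add: q id_plus_0)
  then have "q \<noteq> 0" by auto
  moreover have "poly q t = 0" if "x \<in> carrier_vec n" "id_plus t V *\<^sub>v x = ones_vec n" "x $ i = 0" for t x
    using cramer_lemma_mat[OF id_plus_carrier[OF V] that(1) i, of t] that by (simp add: q)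
  ultimately show ?thesis
    using poly_roots_finite[of q] by (auto elim: rev_finite_subset)
qed

section \<open>Signs of the inverse for fixed t and the limit from the left\<close>

text \<open>Carries \<open>increasing_cbf_inverse\<close> over to \<open>mat_inv\<close>. The
  vectors W 1 and W' 1 solve the row and column systems, and the nonvanishing hypotheses upgrade
  their nonnegative entries to positive ones.\<close>

lemma increasing_cbf_mat_inv:
  fixes t :: real and U :: "real mat"
  defines "W \<equiv> mat_inv (id_plus t U)"
  assumes U: "increasing_cbf U" "nonneg_mat U" "U \<in> carrier_mat n n" and t: "0 \<le> t"
    and det: "det (id_plus t U) \<noteq> 0"
    and row: "nonneg_vec (W *\<^sub>v ones_vec n)" and col: "nonneg_vec (transpose_mat W *\<^sub>v ones_vec n)"
    and row_nz: "\<And>x i. x \<in> carrier_vec n \<Longrightarrow> id_plus t U *\<^sub>v x = ones_vec n \<Longrightarrow> i < n \<Longrightarrow> x $ i \<noteq> 0"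
    and col_nz: "\<And>x i. x \<in> carrier_vec n \<Longrightarrow> id_plus t (transpose_mat U) *\<^sub>v x = ones_vec n
      \<Longrightarrow> i < n \<Longrightarrow> x $ i \<noteq> 0"
  shows "(\<forall>i<n. 0 < W $$ (i, i) \<and> W $$ (i, i) \<le> 1) \<and>
    (\<forall>i<n. \<forall>j<n. i \<noteq> j \<longrightarrow> W $$ (i, j) \<le> 0)"
proof -
  let ?A = "id_plus t U" and ?V = "map_mat (\<lambda>x. t * x - 0) U"
  have A: "?A \<in> carrier_mat n n" using U by simp
  then have W: "W \<in> carrier_mat n n" "?A * W = 1\<^sub>m n" "W * ?A = 1\<^sub>m n"
    using mat_inv_inverts invertible_mat_iff_det det unfolding W_def by blast+
  define x y where "x = W *\<^sub>v ones_vec n" and "y = transpose_mat W *\<^sub>v ones_vec n"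
  have xy: "x \<in> carrier_vec n" "y \<in> carrier_vec n" using W by (auto simp: x_def y_def)
  have Ax: "?A *\<^sub>v x = ones_vec n"
    using A W unfolding x_def by (subst assoc_mult_mat_vec[symmetric]) auto
  have "transpose_mat ?A * transpose_mat W = 1\<^sub>m n"
    using transpose_mult[OF W(1) A] W(3) by simp
  then have Ay: "id_plus t (transpose_mat U) *\<^sub>v y = ones_vec n"
    using A W unfolding y_def id_plus_transpose[OF U(3)]
    by (subst assoc_mult_mat_vec[symmetric]) auto
  have "\<forall>i<n. 0 \<le> x $ i" "\<forall>i<n. 0 \<le> y $ i"
    using row col xy by (auto simp: nonneg_vec_def simp flip: x_def y_def)
  then have pos: "0 < x $ i" "0 < y $ i" if "i < n" for i
    using row_nz[OF xy(1) Ax that] col_nz[OF xy(2) Ay that] that by (auto simp: order_less_le)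
  have x_eq: "x $ i + (\<Sum>k<n. ?V $$ (i, k) * x $ k) = 1" if "i < n" for i
    using arg_cong[OF Ax, of "\<lambda>v. v $ i"] that U(3) xy mult_mat_vec_index[OF U(3) xy(1) that]
    by (simp add: id_plus_mult_vec sum_distrib_left mult.assoc del: index_mult_mat_vec)
  have y_eq: "y $ j + (\<Sum>k<n. y $ k * ?V $$ (k, j)) = 1" if "j < n" for j
    using arg_cong[OF Ay, of "\<lambda>v. v $ j"] that U(3) xy
      mult_mat_vec_index[of "transpose_mat U" n n y j]
    by (simp add: id_plus_mult_vec sum_distrib_left ac_simps del: index_mult_mat_vec)
  have inc: "increasing_cbf ?V" using U(1) t by (rule increasing_cbf_affine)
  have V: "nonneg_mat ?V" "?V \<in> carrier_mat n n"
    using U t by (auto simp: nonneg_mat_iff)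
  from increasing_cbf_inverse[OF inc V, of "\<lambda>i. x $ i" "\<lambda>i. y $ i"]
  obtain C where C: "\<forall>i<n. \<forall>j<n. C i j + (\<Sum>k<n. ?V $$ (i, k) * C k j) = of_bool (i = j)"
    "\<forall>i<n. 0 < C i i \<and> C i i \<le> 1" "\<forall>i<n. \<forall>j<n. i \<noteq> j \<longrightarrow> C i j \<le> 0"
    using pos x_eq y_eq by (elim meta_impE exE conjE)
  define B where "B = mat n n (\<lambda>(i, j). C i j)"
  have B: "B \<in> carrier_mat n n" by (simp add: B_def)
  have "?A * B = 1\<^sub>m n"
  proof (rule eq_matI)
    fix i j assume "i < dim_row (1\<^sub>m n :: real mat)" "j < dim_col (1\<^sub>m n :: real mat)"
    then have ij: "i < n" "j < n" by simp_all
    define c where "c = col B j"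
    have c: "c \<in> carrier_vec n" "\<And>k. k < n \<Longrightarrow> c $ k = C k j"
      using ij by (simp_all add: c_def B_def)
    have "(?A * B) $$ (i, j) = (?A *\<^sub>v c) $ i"
      using A B ij by (simp add: c_def)
    also have "\<dots> = c $ i + t * (\<Sum>k<n. U $$ (i, k) * c $ k)"
      using U(3) c(1) ij mult_mat_vec_index[OF U(3) c(1) ij(1)]
      by (simp add: id_plus_mult_vec del: index_mult_mat_vec)
    also have "\<dots> = of_bool (i = j)"
      using C(1) ij U(3) by (simp add: c(2) sum_distrib_left mult.assoc)
    finally show "(?A * B) $$ (i, j) = (1\<^sub>m n) $$ (i, j)" using ij by simp
  qed (use A B in auto)
  \<comment> \<open>A right inverse of the matrix coincides with its two-sided inverse
    \<open>W\<close>.\<close>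
  then have "W = B"
    using W A B by (metis assoc_mult_mat left_mult_one_mat right_mult_one_mat)
  then show ?thesis using C(2,3) by (simp add: B_def)
qed

text \<open>Weak inequalities survive the limit. Nonsingularity at \<open>r\<close> and strict
  positivity of the diagonal are not closed conditions and are recovered separately.\<close>

lemma bi_potential_left_limit:
  fixes r :: real and U :: "real mat"
  defines "W \<equiv> \<lambda>t. mat_inv (id_plus t U)"
  assumes U: "U \<in> carrier_mat n n" "nonneg_mat U" and r: "0 \<le> r"
    and det: "\<forall>\<^sub>F t in at_left r. det (id_plus t U) \<noteq> 0"
    and diag: "\<forall>\<^sub>F t in at_left r. \<forall>i<n. 0 < W t $$ (i, i) \<and> W t $$ (i, i) \<le> 1"
    and offdiag: "\<forall>\<^sub>F t in at_left r. \<forall>i<n. \<forall>j<n. i \<noteq> j \<longrightarrow> W t $$ (i, j) \<le> 0"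
    and row: "\<forall>\<^sub>F t in at_left r. nonneg_vec (W t *\<^sub>v ones_vec n)"
    and col: "\<forall>\<^sub>F t in at_left r. nonneg_vec (transpose_mat (W t) *\<^sub>v ones_vec n)"
  shows "bi_potential (id_plus r U)"
proof -
  let ?A = "\<lambda>t. id_plus t U"
  have A: "?A t \<in> carrier_mat n n" for t using U by simp
  have inv: "\<forall>\<^sub>F t in at_left r. W t \<in> carrier_mat n n \<and> W t * ?A t = 1\<^sub>m n"
    using det
  proof eventually_elim
    case (elim t)
    then have "invertible_mat (?A t)" using invertible_mat_iff_det[OF A] by simp
    then show ?case using mat_inv_inverts[OF A] by (simp add: W_def)
  qed
  have row': "\<forall>\<^sub>F t in at_left r. \<forall>i<n. 0 \<le> (\<Sum>j<n. W t $$ (i, j))"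
    using inv row
  proof eventually_elim
    case (elim t)
    then show ?case
      using mult_mat_vec_index[of "W t" n n "ones_vec n"] carrier_matD[of "W t" n n]
      by (simp add: nonneg_vec_def del: index_mult_mat_vec)
  qed
  have col': "\<forall>\<^sub>F t in at_left r. \<forall>j<n. 0 \<le> (\<Sum>i<n. W t $$ (i, j))"
    using inv col
  proof eventually_elim
    case (elim t)
    then show ?case
      using mult_mat_vec_index[of "transpose_mat (W t)" n n "ones_vec n"] carrier_matD[of "W t" n n]
      by (simp add: nonneg_vec_def del: index_mult_mat_vec)
  qed
  \<comment> \<open>Dropping the other, nonpositive entries from a nonnegative row sum leaves 0
    \<le> W_ii + W_ij, so W_ii \<le> 1 bounds the whole row.\<close>
  have bounded: "\<forall>\<^sub>F t in at_left r. \<forall>i<n. \<forall>j<n. \<bar>W t $$ (i, j)\<bar> \<le> 1"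
    using diag offdiag row'
  proof eventually_elim
    case (elim t)
    have "\<bar>W t $$ (i, j)\<bar> \<le> 1" if ij: "i < n" "j < n" "i \<noteq> j" for i j
    proof -
      have "(\<Sum>k<n. W t $$ (i, k))
        = (\<Sum>k\<in>{..<n} - {i, j}. W t $$ (i, k)) + (\<Sum>k\<in>{i, j}. W t $$ (i, k))"
        using ij by (intro sum.subset_diff) auto
      moreover have "(\<Sum>k\<in>{..<n} - {i, j}. W t $$ (i, k)) \<le> 0"
        using elim(2) ij by (intro sum_nonpos) auto
      ultimately have "0 \<le> W t $$ (i, i) + W t $$ (i, j)"
        using elim(3) ij by force
      then show ?thesis using elim(1,2) ij by force
    qed
    then show ?case using elim by (metis abs_of_pos)
  qed
  \<comment> \<open>Since the matrix at \<open>r\<close> is the one at \<open>t\<close> plus (r - t)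
    U, the error is (r - t) W(t) U x, where W(t) is bounded. The claim avoids the inverse at
    \<open>r\<close>, whose existence is still open.\<close>
  have lim: "((\<lambda>t. (W t *\<^sub>v (?A r *\<^sub>v x)) $ i) \<longlongrightarrow> x $ i) (at_left r)"
    if x: "x \<in> carrier_vec n" and i: "i < n" for x i
  proof -
    let ?u = "U *\<^sub>v x"
    have u: "?u \<in> carrier_vec n" using U(1) x by (rule mult_mat_vec_carrier)
    define K where "K = (\<Sum>j<n. \<bar>?u $ j\<bar>)"
    have "\<forall>\<^sub>F t in at_left r. norm ((W t *\<^sub>v (?A r *\<^sub>v x)) $ i - x $ i) \<le> \<bar>r - t\<bar> * K"
      using inv bounded
    proof eventually_elim
      case (elim t)
      have "?A r *\<^sub>v x = ?A t *\<^sub>v x + (r - t) \<cdot>\<^sub>v ?u"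
        using U x by (intro eq_vecI) (auto simp: id_plus_mult_vec algebra_simps)
      then have "W t *\<^sub>v (?A r *\<^sub>v x) = x + (r - t) \<cdot>\<^sub>v (W t *\<^sub>v ?u)"
        using elim(1) A[of t] x u
        by (simp add: mult_add_distrib_mat_vec[of _ n n] mult_mat_vec[of _ n n]
            assoc_mult_mat_vec[of _ n n _ n, symmetric])
      then have "(W t *\<^sub>v (?A r *\<^sub>v x)) $ i - x $ i = (r - t) * (\<Sum>j<n. W t $$ (i, j) * ?u $ j)"
        using mult_mat_vec_index[of "W t" n n ?u i] elim x i u carrier_matD[of "W t" n n]
        by (simp del: index_mult_mat_vec)
      moreover have "\<bar>\<Sum>j<n. W t $$ (i, j) * ?u $ j\<bar> \<le> K"
        unfolding K_def
        using elim(2) i by (intro order_trans[OF sum_abs] sum_mono) (auto simp: abs_mult intro: mult_left_le_one_le)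
      ultimately show ?case by (simp add: abs_mult mult_left_mono)
    qed
    then have bound: "\<forall>\<^sub>F t in at_left r. norm ((W t *\<^sub>v (?A r *\<^sub>v x)) $ i - x $ i) \<le> norm (r - t) * K"
      by (simp only: real_norm_def)
    have "((\<lambda>t. r - t) \<longlongrightarrow> 0) (at_left r)"
      by (auto intro!: tendsto_eq_intros)
    from tendsto_0_le[OF this bound]
    have "((\<lambda>t. (W t *\<^sub>v (?A r *\<^sub>v x)) $ i - x $ i) \<longlongrightarrow> 0) (at_left r)" .
    then show ?thesis using LIM_zero_iff by blast
  qed
  \<comment> \<open>For a kernel vector \<open>v\<close> the expression in \<open>lim\<close> is
    eventually 0 and yet tends to \<open>v\<close>.\<close>
  have "det (?A r) \<noteq> 0"
  proof
    assume "det (?A r) = 0"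
    then obtain v where v: "v \<in> carrier_vec n" "v \<noteq> 0\<^sub>v n" "?A r *\<^sub>v v = 0\<^sub>v n"
      using det_0_iff_vec_prod_zero_field[OF A] by auto
    have "v $ i = 0" if i: "i < n" for i
    proof -
      have "\<forall>\<^sub>F t in at_left r. (W t *\<^sub>v (?A r *\<^sub>v v)) $ i = 0"
        using inv by eventually_elim (use v(3) i in \<open>auto simp: scalar_prod_def\<close>)
      then have "((\<lambda>t. (W t *\<^sub>v (?A r *\<^sub>v v)) $ i) \<longlongrightarrow> 0) (at_left r)"
        by (rule tendsto_eventually)
      then show ?thesis
        using lim[OF v(1) i] tendsto_unique trivial_limit_at_left_real by blast
    qed
    then show False using v by (auto intro: eq_vecI)
  qed
  then have inv_r: "invertible_mat (?A r)" using invertible_mat_iff_det[OF A] by blast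
  define M where "M = W r"
  have M: "M \<in> carrier_mat n n" "?A r * M = 1\<^sub>m n" "M * ?A r = 1\<^sub>m n"
    using mat_inv_inverts[OF A inv_r] by (simp_all add: M_def W_def)
  have limM: "((\<lambda>t. W t $$ (i, j)) \<longlongrightarrow> M $$ (i, j)) (at_left r)" if ij: "i < n" "j < n" for i j
  proof -
    \<comment> \<open>Applying \<open>lim\<close> to column \<open>j\<close> of \<open>M\<close>
      makes W(t) act on a unit vector, which selects its column \<open>j\<close>.\<close>
    have unit: "?A r *\<^sub>v col M j = unit_vec n j"
      using M A[of r] ij by (metis col_mult2 col_one)
    have "\<forall>\<^sub>F t in at_left r. (W t *\<^sub>v (?A r *\<^sub>v col M j)) $ i = W t $$ (i, j)"
      using inv by eventually_elim (use ij in \<open>auto simp: unit\<close>)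
    moreover have "((\<lambda>t. (W t *\<^sub>v (?A r *\<^sub>v col M j)) $ i) \<longlongrightarrow> M $$ (i, j)) (at_left r)"
      using lim[of "col M j" i] M ij by auto
    ultimately show ?thesis
      by (rule Lim_transform_eventually[rotated])
  qed
  have M_off: "M $$ (i, j) \<le> 0" if "i < n" "j < n" "i \<noteq> j" for i j
    by (rule tendsto_upperbound[OF limM[OF that(1,2)]])
      (use offdiag that in \<open>auto elim: eventually_mono\<close>)
  have M_diag: "0 \<le> M $$ (i, i)" if "i < n" for i
    by (rule tendsto_lowerbound[OF limM[OF that that]])
      (use diag that in \<open>auto elim!: eventually_mono simp: less_imp_le\<close>)
  have M_row: "0 \<le> (\<Sum>j<n. M $$ (i, j))" if "i < n" for i
    by (rule tendsto_lowerbound[OF tendsto_sum[OF limM[OF that]]])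
      (use row' that in \<open>auto elim: eventually_mono\<close>)
  have M_col: "0 \<le> (\<Sum>i<n. M $$ (i, j))" if "j < n" for j
    by (rule tendsto_lowerbound[OF tendsto_sum[OF limM[OF _ that]]])
      (use col' that in \<open>auto elim: eventually_mono\<close>)
  \<comment> \<open>A zero diagonal entry leaves only nonpositive entries in a row with nonnegative
    sum; the row then vanishes, contradicting that \<open>M\<close> is an inverse.\<close>
  have "M $$ (i, i) \<noteq> 0" if i: "i < n" for i
  proof
    assume Mii: "M $$ (i, i) = 0"
    have nonpos: "\<And>j. j \<in> {..<n} \<Longrightarrow> 0 \<le> - M $$ (i, j)"
      using M_off[OF i] Mii by (metis le_minus_iff lessThan_iff minus_zero order_refl)
    moreover have "(\<Sum>j<n. - M $$ (i, j)) = 0"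
      using M_row[OF i] sum_nonneg[of "{..<n}" "\<lambda>j. - M $$ (i, j)"] nonpos by (simp add: sum_negf)
    ultimately have "M $$ (i, j) = 0" if "j < n" for j
      using sum_nonneg_eq_0_iff[of "{..<n}" "\<lambda>j. - M $$ (i, j)"] that by auto
    then have "(M * ?A r) $$ (i, i) = 0"
      using M(1) A[of r] i by (simp add: scalar_prod_def)
    then show False using M(3) i by simp
  qed
  then have "0 < M $$ (i, i)" if "i < n" for i
    using M_diag that by (metis order_le_less)
  moreover have "nonneg_mat (?A r)"
    using U r by (simp add: nonneg_mat_iff[of _ n n] id_plus_index)
  ultimately show ?thesis
    using A[of r] inv_r M_off M_row M_col
    by (simp add: bi_potential_def Let_def M_def W_def)
qed


section \<open>Comparison of the two infima\<close>

lemma bi_potential_one: "bi_potential (1\<^sub>m n)"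
proof -
  have inv: "invertible_mat (1\<^sub>m n :: real mat)"
    using invertible_mat_iff_det[of "1\<^sub>m n :: real mat" n] by simp
  then have "mat_inv (1\<^sub>m n) = 1\<^sub>m n"
    using mat_inv_inverts[of "1\<^sub>m n" n] by (metis left_mult_one_mat one_carrier_mat)
  then show ?thesis
    using inv by (auto simp: bi_potential_def Let_def nonneg_mat_iff[of _ n n] intro!: sum_nonneg)
qed

lemma eventually_notin_finite:
  fixes F :: "'a :: t1_space set"
  assumes "finite F"
  shows "\<forall>\<^sub>F t in at x within S. t \<notin> F"
proof -
  \<comment> \<open>The point \<open>x\<close> may lie in \<open>F\<close>: the filter at
    \<open>x\<close> ignores it, so only F - {x} has to be avoided.\<close>
  have "open (- (F - {x}))"
    using assms by (intro open_Compl finite_imp_closed) simp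
  then have "\<forall>\<^sub>F t in at x. t \<notin> F"
    unfolding eventually_at_topological by blast
  then show ?thesis
    using filter_leD[OF at_le[OF subset_UNIV]] by blast
qed

text \<open>The hypothesis concerns only parameters strictly below \<open>r\<close>. The point
  \<open>r\<close> itself, possibly exceptional, is reached as a limit from the left along good
  parameters.\<close>

lemma bi_potential_id_plus:
  assumes U: "increasing_cbf U" "nonneg_mat U" "U \<in> carrier_mat n n" and r: "0 \<le> r"
    and sums: "\<And>t. 0 < t \<Longrightarrow> t < r \<Longrightarrow> invertible_mat (id_plus t U) \<Longrightarrow>
      nonneg_vec (mat_inv (id_plus t U) *\<^sub>v ones_vec n) \<and>
      nonneg_vec (transpose_mat (mat_inv (id_plus t U)) *\<^sub>v ones_vec n)"
  shows "bi_potential (id_plus r U)"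
\<comment> \<open>At 0 there are no positive parameters to the left, so the identity matrix is
  treated directly.\<close>
proof (cases "r = 0")
  case True
  then show ?thesis using bi_potential_one id_plus_0[OF U(3)] by simp
next
  case False
  define Z where "Z V = (\<Union>i<n. {t. \<exists>x \<in> carrier_vec n. id_plus t V *\<^sub>v x = ones_vec n \<and> x $ i = 0})"
    for V
  \<comment> \<open>Exceptional parameters: singular ones and those where a row or column solution
    has a zero entry; the transpose accounts for the columns.\<close>
  define F where "F = {t. det (id_plus t U) = 0} \<union> Z U \<union> Z (transpose_mat U)"
  have "finite F"
    unfolding F_def Z_def
    using finite_singular_id_plus[OF U(3)] finite_vanishing_solution[OF U(3)]
      finite_vanishing_solution[of "transpose_mat U" n] U(3) by auto
  then have ev: "\<forall>\<^sub>F t in at_left r. t \<in> {0<..<r} \<and> t \<notin> F"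
    using eventually_notin_finite[of F] eventually_at_left_real[of 0 r] r False
    by (intro eventually_conj) auto
  have good: "det (id_plus t U) \<noteq> 0" "nonneg_vec (mat_inv (id_plus t U) *\<^sub>v ones_vec n)"
    "nonneg_vec (transpose_mat (mat_inv (id_plus t U)) *\<^sub>v ones_vec n)"
    "\<forall>i<n. 0 < mat_inv (id_plus t U) $$ (i, i) \<and> mat_inv (id_plus t U) $$ (i, i) \<le> 1"
    "\<forall>i<n. \<forall>j<n. i \<noteq> j \<longrightarrow> mat_inv (id_plus t U) $$ (i, j) \<le> 0"
    if t: "t \<in> {0<..<r} \<and> t \<notin> F" for t
  proof -
    show det: "det (id_plus t U) \<noteq> 0" using t by (simp add: F_def)
    then have "invertible_mat (id_plus t U)"
      using invertible_mat_iff_det[of "id_plus t U" n] U(3) by simp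
    then show nonneg: "nonneg_vec (mat_inv (id_plus t U) *\<^sub>v ones_vec n)"
      "nonneg_vec (transpose_mat (mat_inv (id_plus t U)) *\<^sub>v ones_vec n)"
      using sums t by simp_all
    show "\<forall>i<n. 0 < mat_inv (id_plus t U) $$ (i, i) \<and> mat_inv (id_plus t U) $$ (i, i) \<le> 1"
      "\<forall>i<n. \<forall>j<n. i \<noteq> j \<longrightarrow> mat_inv (id_plus t U) $$ (i, j) \<le> 0"
      using increasing_cbf_mat_inv[OF U _ det nonneg] t by (auto simp: F_def Z_def)
  qed
  show ?thesis
    by (rule bi_potential_left_limit[OF U(3,2) r]; rule eventually_mono[OF ev]; rule good)
qed

text \<open>The components of these vectors are the row and column sums of the inverse. Thus a
  parameter that violates the sum condition also violates the bi-potential condition.\<close>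

lemma bi_potential_imp_nonneg_sums:
  assumes V: "V \<in> carrier_mat n n" and "bi_potential V"
  shows "nonneg_vec (mat_inv V *\<^sub>v ones_vec n)" "nonneg_vec (transpose_mat (mat_inv V) *\<^sub>v ones_vec n)"
proof -
  have W: "mat_inv V \<in> carrier_mat n n"
    using mat_inv_inverts(1)[OF V] assms(2) by (simp add: bi_potential_def)
  then show "nonneg_vec (mat_inv V *\<^sub>v ones_vec n)" "nonneg_vec (transpose_mat (mat_inv V) *\<^sub>v ones_vec n)"
    using assms mult_mat_vec_index[OF W, of "ones_vec n"]
      mult_mat_vec_index[of "transpose_mat (mat_inv V)" n n "ones_vec n"]
    by (auto simp: nonneg_vec_def bi_potential_def Let_def)
qed

theorem theorem2p6:
  fixes U :: "real mat"
  assumes "increasing_cbf U" and "nonneg_mat U"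
  shows "class_T U"
proof -
  define n where "n = dim_row U"
  have U: "U \<in> carrier_mat n n"
    using cbf_square[OF increasing_cbf_imp_cbf[OF assms(1)]] by (auto simp: n_def)
  define T where "T = {t. 0 < t \<and> invertible_mat (id_plus t U) \<and>
    (\<not> nonneg_vec (mat_inv (id_plus t U) *\<^sub>v ones_vec n) \<or>
     \<not> nonneg_vec (transpose_mat (mat_inv (id_plus t U)) *\<^sub>v ones_vec n))}"
  \<comment> \<open>The value \<open>r\<close> may equal the infimum; this endpoint is what yields
    nonsingularity at \<open>tau U\<close>.\<close>
  have bi_pot: "bi_potential (id_plus r U)" if "0 \<le> r" "ereal r \<le> Inf (ereal ` T)" for r
  proof (rule bi_potential_id_plus[OF assms U that(1)])
    fix t :: real assume t: "0 < t" "t < r" "invertible_mat (id_plus t U)"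
    then have "ereal t < Inf (ereal ` T)" using that(2) by (simp add: less_le_trans[of _ "ereal r"])
    then have "t \<notin> T" using Inf_lower[of "ereal t" "ereal ` T"] by (auto simp: not_le[symmetric])
    then show "nonneg_vec (mat_inv (id_plus t U) *\<^sub>v ones_vec n) \<and>
      nonneg_vec (transpose_mat (mat_inv (id_plus t U)) *\<^sub>v ones_vec n)"
      using t by (auto simp: T_def)
  qed
  have tau: "tau U = Inf (ereal ` T)"
  proof (rule antisym)
    show "tau U \<le> Inf (ereal ` T)"
      unfolding tau_def
      using bi_potential_imp_nonneg_sums[OF id_plus_carrier[OF U]]
      by (intro Inf_superset_mono image_mono) (auto simp: T_def)
    \<comment> \<open>By \<open>bi_pot\<close>, a nonnegative parameter without the bi-potential
      property cannot lie at or below the infimum of \<open>T\<close>.\<close>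
    show "Inf (ereal ` T) \<le> tau U"
      unfolding tau_def
    proof (rule Inf_greatest)
      fix x assume "x \<in> ereal ` {t. 0 \<le> t \<and> \<not> bi_potential (id_plus t U)}"
      then obtain t where "x = ereal t" "0 \<le> t" "\<not> bi_potential (id_plus t U)" by auto
      then show "Inf (ereal ` T) \<le> x" using bi_pot[of t] linear by blast
    qed
  qed
  have "invertible_mat (id_plus t U)" if "tau U = ereal t" for t
  proof -
    have "0 \<le> Inf (ereal ` T)" by (rule Inf_greatest) (auto simp: T_def)
    then have "bi_potential (id_plus t U)" using bi_pot[of t] that tau by simp
    then show ?thesis by (simp add: bi_potential_def)
  qed
  moreover have "square_mat U" using U by simp
  ultimately show ?thesis
    unfolding class_T_def using assms(2) tau[unfolded T_def n_def] by blast
qed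

end
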